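(* Let $G = K \rtimes_\theta Q \neq 1$ be a split extension, with associated homomorphisms $\pi : G \to \mathrm{Aut}(K)$ and $\Theta : FC(Q) \to \mathrm{Out}(K)$. Then $G$ is not icc if and only if at least one of the following conditions is satisfied: \begin{itemize} \item[(i)] $K$ contains a normal subgroup $N \neq 1$ preserved under the action of $\pi(G)$ and such that either $N$ is finite, or $N \cong \mathbb{Z}^n$ (for some $n$) has only finite $\pi(G)$-orbits; \item[(ii)] $\ker \Theta$ contains an element $q \neq 1$ such that, for some $k \in K$ with finite $\theta(Q)$-orbit, $\theta_q(x) = k^{-1} x k$ for all $x \in K$. \end{itemize}
   Context: A group is icc (has infinite conjugacy classes) if it is non-trivial and all its conjugacy classes other than $\{1\}$ are infinite. For a group $H$, $FC(H)$ denotes the (characteristic) subgroup of all elements of $H$ whose conjugacy class in $H$ is finite. $G = K \rtimes_\theta Q$ denotes the split extension (semi-direct product) with normal factor $K$, retract factor $Q$ (both viewed as subgroups of $G$) and associated homomorphism $\theta : Q \to \mathrm{Aut}(K)$, with the convention $q^{-1} k q = \theta(q)(k)$ for $k \in K$, $q \in Q$; we write $\theta_q = \theta(q)$. The homomorphism $\pi : G \to \mathrm{Aut}(K)$ is defined by $\pi(g)(k) = g^{-1} k g$ for $g \in G$, $k \in K$; it extends $\theta$. (Composition in $\mathrm{Aut}(K)$ is taken in the order that makes these maps homomorphisms.) $\Theta : FC(Q) \to \mathrm{Out}(K)$ is the homomorphism induced by $\theta$, i.e. the restriction of $\theta$ to $FC(Q)$ followed by the quotient map $\mathrm{Aut}(K)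 \to \mathrm{Out}(K) = \mathrm{Aut}(K)/\mathrm{Inn}(K)$. Orbits are those of the natural actions of the subgroups $\theta(Q), \pi(G) \le \mathrm{Aut}(K)$ on $K$. *)

theory Defs
  imports "HOL-Algebra.Algebra"
begin

text \<open>
  A subgroup \<open>H\<close> of \<open>G\<close>, regarded as a group in its own right, is \<open>G\<lparr>carrier := H\<rparr>\<close>.
\<close>

definition conj_class :: "('a, 'b) monoid_scheme \<Rightarrow> 'a \<Rightarrow> 'a set"
  where "conj_class G x = {inv\<^bsub>G\<^esub> g \<otimes>\<^bsub>G\<^esub> x \<otimes>\<^bsub>G\<^esub> g | g. g \<in> carrier G}"

definition icc :: "('a, 'b) monoid_scheme \<Rightarrow> bool"
  where "icc G \<longleftrightarrow> carrier G \<noteq> {\<one>\<^bsub>G\<^esub>} \<and>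
    (\<forall>C \<in> conj_class G ` carrier G. C \<noteq> {\<one>\<^bsub>G\<^esub>} \<longrightarrow> infinite C)"

definition FC :: "('a, 'b) monoid_scheme \<Rightarrow> 'a set"
  where "FC G = {x \<in> carrier G. finite (conj_class G x)}"

text \<open>
  With the convention \<open>q\<^sup>-\<^sup>1 k q = \<theta>\<^sub>q(k)\<close>, conjugation is a right action, so it is a homomorphism
  only into the group in which \<open>f g\<close> means ``first \<open>f\<close>, then \<open>g\<close>''. This is the opposite of
  the library's \<open>AutoGroup\<close>.
\<close>

definition Aut :: "('a, 'b) monoid_scheme \<Rightarrow> ('a \<Rightarrow> 'a) monoid"
  where "Aut K = (AutoGroup K)\<lparr>mult := \<lambda>f g. g \<otimes>\<^bsub>AutoGroup K\<^esub> f\<rparr>"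

text \<open>The homomorphism \<open>\<pi> : G \<rightarrow> Aut K\<close>: conjugation of \<open>G\<close> on a normal subgroup \<open>K\<close>.\<close>

definition conj_hom :: "('a, 'b) monoid_scheme \<Rightarrow> 'a set \<Rightarrow> 'a \<Rightarrow> 'a \<Rightarrow> 'a"
  where "conj_hom G K g = (\<lambda>k\<in>K. inv\<^bsub>G\<^esub> g \<otimes>\<^bsub>G\<^esub> k \<otimes>\<^bsub>G\<^esub> g)"

definition Inn :: "('a, 'b) monoid_scheme \<Rightarrow> ('a \<Rightarrow> 'a) set"
  where "Inn K = conj_hom K (carrier K) ` carrier K"

definition Out :: "('a, 'b) monoid_scheme \<Rightarrow> ('a \<Rightarrow> 'a) set monoid"
  where "Out K = Aut K Mod Inn K"

text \<open>A homomorphism into \<open>Aut K\<close> followed by the quotient map onto \<open>Out K\<close>.\<close>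

definition to_Out :: "('a, 'b) monoid_scheme \<Rightarrow> ('q \<Rightarrow> 'a \<Rightarrow> 'a) \<Rightarrow> 'q \<Rightarrow> ('a \<Rightarrow> 'a) set"
  where "to_Out K \<theta> q = Inn K #>\<^bsub>Aut K\<^esub> \<theta> q"

text \<open>\<open>G\<close> is the (internal) semidirect product of \<open>K\<close> and \<open>Q\<close> with associated homomorphism \<open>\<theta>\<close>.\<close>

definition split_extension ::
  "('a, 'b) monoid_scheme \<Rightarrow> 'a set \<Rightarrow> 'a set \<Rightarrow> ('a \<Rightarrow> 'a \<Rightarrow> 'a) \<Rightarrow> bool"
  where "split_extension G K Q \<theta> \<longleftrightarrow>
    group G \<and> K \<lhd> G \<and> subgroup Q G \<and> K \<inter> Q = {\<one>\<^bsub>G\<^esub>} \<and> K <#>\<^bsub>G\<^esub> Q = carrier G \<and>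
    \<theta> \<in> hom (G\<lparr>carrier := Q\<rparr>) (Aut (G\<lparr>carrier := K\<rparr>)) \<and>
    (\<forall>q\<in>Q. \<forall>k\<in>K. inv\<^bsub>G\<^esub> q \<otimes>\<^bsub>G\<^esub> k \<otimes>\<^bsub>G\<^esub> q = \<theta> q k)"

definition free_abelian_rank :: "nat \<Rightarrow> (nat \<Rightarrow> int) monoid"
  where "free_abelian_rank n = product_group {..<n} (\<lambda>_. integer_group)"


lemma carrier_Aut: "carrier (Aut K) = auto K"
  by (simp add: Aut_def AutoGroup_def)

lemma one_Aut: "\<one>\<^bsub>Aut K\<^esub> = (\<lambda>x\<in>carrier K. x)"
  by (simp add: Aut_def AutoGroup_def BijGroup_def)

lemma mult_Aut:
  "\<lbrakk>f \<in> auto K; g \<in> auto K\<rbrakk> \<Longrightarrow> f \<otimes>\<^bsub>Aut K\<^esub> g = compose (carrier K) g f"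
  by (simp add: Aut_def AutoGroup_def BijGroup_def auto_def)

lemma group_Aut:
  assumes "group K" shows "group (Aut K)"
proof -
  interpret A: group "AutoGroup K" using assms by (rule group.AutoGroup)
  show ?thesis
    by (rule groupI) (auto simp: Aut_def A.m_assoc intro: A.r_inv_ex)
qed

lemma conj_hom_in_auto:
  fixes G (structure)
  assumes "K \<lhd> G" "g \<in> carrier G"
  shows "conj_hom G K g \<in> auto (G\<lparr>carrier := K\<rparr>)"
proof -
  interpret normal K G by fact
  have cl: "inv g \<otimes> k \<otimes> g \<in> K" "g \<otimes> k \<otimes> inv g \<in> K" if "k \<in> K" for k
    using inv_op_closed1 inv_op_closed2 that assms(2) by auto
  have c: "g \<otimes> (inv g \<otimes> y) = y" "inv g \<otimes> (g \<otimes> y) = y" if "y \<in> carrier G" for y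
    using that assms(2) by (simp_all flip: m_assoc)
  have "bij_betw (conj_hom G K g) K K"
    by (rule bij_betw_byWitness[where f' = "\<lambda>k. g \<otimes> k \<otimes> inv g"])
       (use assms(2) cl in \<open>auto simp: conj_hom_def m_assoc c\<close>)
  moreover have "conj_hom G K g \<in> hom (G\<lparr>carrier := K\<rparr>) (G\<lparr>carrier := K\<rparr>)"
    using assms(2) cl by (auto intro!: homI simp: conj_hom_def m_assoc c)
  ultimately show ?thesis
    by (simp add: auto_def Bij_def conj_hom_def)
qed

lemma conj_hom_hom:
  fixes G (structure)
  assumes "K \<lhd> G"
  shows "conj_hom G K \<in> hom G (Aut (G\<lparr>carrier := K\<rparr>))"
proof (rule homI)
  interpret normal K G by fact
  fix g h assume gh: "g \<in> carrier G" "h \<in> carrier G"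
  show "conj_hom G K g \<in> carrier (Aut (G\<lparr>carrier := K\<rparr>))"
    using conj_hom_in_auto[OF assms gh(1)] by (simp add: carrier_Aut)
  have cl: "inv g \<otimes> k \<otimes> g \<in> K" if "k \<in> K" for k
    using inv_op_closed1 that gh by auto
  show "conj_hom G K (g \<otimes> h) = conj_hom G K g \<otimes>\<^bsub>Aut (G\<lparr>carrier := K\<rparr>)\<^esub> conj_hom G K h"
    using gh cl conj_hom_in_auto[OF assms gh(1)] conj_hom_in_auto[OF assms gh(2)]
    by (simp add: mult_Aut)
       (auto simp: compose_def conj_hom_def fun_eq_iff m_assoc inv_mult_group)
qed

lemma Inn_normal:
  assumes "group K" shows "Inn K \<lhd> Aut K"
proof -
  interpret K: group K by fact
  interpret A: group "Aut K" by (rule group_Aut) fact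
  have nK: "carrier K \<lhd> K"
    by (simp add: K.normal_inv_iff K.subgroup_self)
  have h: "conj_hom K (carrier K) \<in> hom K (Aut K)"
    using conj_hom_hom[OF nK] by simp
  interpret h: group_hom K "Aut K" "conj_hom K (carrier K)"
    by (simp add: group_hom_def group_hom_axioms_def h assms A.group_axioms)
  have sub: "subgroup (Inn K) (Aut K)"
    unfolding Inn_def by (rule h.img_is_subgroup)
  show ?thesis
  proof (unfold A.normal_inv_iff, intro conjI sub ballI)
    fix f i assume f: "f \<in> carrier (Aut K)" and i: "i \<in> Inn K"
    have j: "inv\<^bsub>Aut K\<^esub> f \<in> carrier (Aut K)" using f by simp
    let ?j = "inv\<^bsub>Aut K\<^esub> f"
    from i obtain k where k: "k \<in> carrier K" and ik: "i = conj_hom K (carrier K) k"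
      unfolding Inn_def by blast
    have ia: "i \<in> carrier (Aut K)" using h k ik by (auto simp: hom_def)
    have jh: "?j \<in> hom K K" using j by (simp add: carrier_Aut auto_def)
    have jk: "?j k \<in> carrier K" using jh k by (auto simp: hom_def)
    have jK: "group_hom K K ?j"
      by (simp add: group_hom_def group_hom_axioms_def jh assms)
    have fa: "f \<in> auto K" and ja: "?j \<in> auto K" using f j by (auto simp: carrier_Aut)
    have ca: "conj_hom K (carrier K) (?j k) \<in> carrier (Aut K)"
      using h jk by (auto simp: hom_def)
    have "i \<otimes>\<^bsub>Aut K\<^esub> ?j = ?j \<otimes>\<^bsub>Aut K\<^esub> conj_hom K (carrier K) (?j k)"
      using ia ja ca k jk jK
      by (auto simp: mult_Aut carrier_Aut ik compose_def conj_hom_def fun_eq_iff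
          group_hom.hom_inv group_hom.hom_closed hom_mult[OF jh])
    hence "f \<otimes>\<^bsub>Aut K\<^esub> i \<otimes>\<^bsub>Aut K\<^esub> ?j =
        f \<otimes>\<^bsub>Aut K\<^esub> ?j \<otimes>\<^bsub>Aut K\<^esub> conj_hom K (carrier K) (?j k)"
      using f j ia ca by (simp only: A.m_assoc carrier_Aut[symmetric])
    also have "\<dots> = conj_hom K (carrier K) (?j k)"
      using f ca by simp
    finally have "f \<otimes>\<^bsub>Aut K\<^esub> i \<otimes>\<^bsub>Aut K\<^esub> ?j = conj_hom K (carrier K) (?j k)" .
    thus "f \<otimes>\<^bsub>Aut K\<^esub> i \<otimes>\<^bsub>Aut K\<^esub> ?j \<in> Inn K"
      using jk by (simp add: Inn_def)
  qed
qed

lemma subgroup_FC: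
  fixes G (structure)
  assumes "group G" shows "subgroup (FC G) G"
proof -
  interpret group G by fact
  have c: "g \<otimes> (inv g \<otimes> y) = y" if "g \<in> carrier G" "y \<in> carrier G" for g y
    using that by (simp flip: m_assoc)
  show ?thesis
  proof (rule subgroupI)
    have "conj_class G \<one> = {\<one>}" by (force simp: conj_class_def)
    hence "\<one> \<in> FC G" by (simp add: FC_def)
    thus "FC G \<noteq> {}" by blast
  next
    fix x assume x: "x \<in> FC G"
    have "conj_class G (inv x) \<subseteq> m_inv G ` conj_class G x"
      using x by (force simp: FC_def conj_class_def inv_mult_group m_assoc)
    thus "inv x \<in> FC G"
      using x by (auto simp: FC_def intro: finite_subset)
  next
    fix x y assume xy: "x \<in> FC G" "y \<in> FC G"
    have "conj_class G (x \<otimes> y) \<subseteq> (\<lambda>(a, b). a \<otimes> b) ` (conj_class G x \<times> conj_class G y)"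
    proof
      fix z assume "z \<in> conj_class G (x \<otimes> y)"
      then obtain g where g: "g \<in> carrier G" "z = inv g \<otimes> (x \<otimes> y) \<otimes> g"
        by (auto simp: conj_class_def)
      hence "z = (inv g \<otimes> x \<otimes> g) \<otimes> (inv g \<otimes> y \<otimes> g)"
        using xy by (simp add: FC_def m_assoc c)
      thus "z \<in> (\<lambda>(a, b). a \<otimes> b) ` (conj_class G x \<times> conj_class G y)"
        using g(1) by (force simp: conj_class_def)
    qed
    thus "x \<otimes> y \<in> FC G"
      using xy by (auto simp: FC_def intro: finite_subset)
  qed (auto simp: FC_def)
qed

lemma group_Out: "group K \<Longrightarrow> group (Out K)"
  unfolding Out_def by (rule normal.factorgroup_is_group) (rule Inn_normal)

lemma to_Out_hom:
  assumes "group K" "\<theta> \<in> hom Q (Aut K)"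
  shows "to_Out K \<theta> \<in> hom Q (Out K)"
proof -
  interpret normal "Inn K" "Aut K" by (rule Inn_normal) fact
  show ?thesis
    using assms(2) r_coset_hom_Mod by (auto simp: to_Out_def Out_def hom_def Pi_iff)
qed

end

theory Submission
  imports Defs
begin

text \<open>
  A non-trivial group is icc exactly when \<open>FC G\<close>, the normal subgroup of the elements with finitely
  many conjugates, is trivial (\<open>not_icc_iff\<close>). So the question is where a non-trivial element \<open>x\<close> of
  \<open>FC G\<close> can come from in \<open>G = K Q\<close>, and the two conditions of the theorem answer the two cases.

  If \<open>FC G\<close> meets \<open>K\<close> non-trivially, condition (i) holds (\<open>normal_subgroup_of_FC_element\<close>). A
  non-trivial torsion element of \<open>K \<inter> FC G\<close> has a finite normal closure: this is Dietzmann's lemma,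
  which says that a finite normal set of elements with a common finite exponent generates a finite
  subgroup (\<open>dietzmann\<close>). If there is no such element, take any \<open>x \<noteq> 1\<close> in \<open>K \<inter> FC G\<close>. Some power \<open>x\<^sup>m\<close>, where
  \<open>m > 0\<close>, centralizes the finite class of \<open>x\<close> (\<open>pow_centralizes_FC\<close>), and so the conjugates of
  \<open>x\<^sup>m\<close> commute with each other (\<open>conj_class_pow_commute\<close>). They generate a normal subgroup that is
  abelian, finitely generated and torsion-free, hence free abelian of finite rank
  (\<open>fin_gen_torsion_free_imp_free\<close>). Conversely, the \<open>\<pi>(G)\<close>-orbits in \<open>K\<close> are conjugacy classes of
  \<open>G\<close>, so the elements of a subgroup as in (i) have finitely many conjugates; when the subgroup is
  finite, this is because it contains these orbits.

  If \<open>FC G\<close> meets \<open>K\<close> trivially, the two normal subgroups commute. Writing \<open>x = q k\<^sup>-\<^sup>1\<close> with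
  \<open>q \<in> Q\<close> and \<open>k \<in> K\<close>, that \<open>x\<close> centralizes \<open>K\<close> means that \<open>q\<close> acts on \<open>K\<close> as conjugation by \<open>k\<close>. For
  such pairs, \<open>q k\<^sup>-\<^sup>1\<close> lies in \<open>FC G\<close> if and only if \<open>q\<close> lies in \<open>FC Q\<close> and \<open>k\<close> has a finite
  \<open>\<theta>(Q)\<close>-orbit (\<open>centralizer_mem_FC_iff\<close>). This equivalence gives condition (ii) from \<open>x\<close>, and
  also \<open>x\<close> from condition (ii).
\<close>

section \<open>Finitely generated torsion-free abelian groups are free\<close>

definition pow_prod :: "('a, 'b) monoid_scheme \<Rightarrow> 'i set \<Rightarrow> ('i \<Rightarrow> 'a) \<Rightarrow> ('i \<Rightarrow> int) \<Rightarrow> 'a"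
  where "pow_prod G I g a = finprod G (\<lambda>i. g i [^]\<^bsub>G\<^esub> a i) I"

text \<open>
  A family is indexed by an arbitrary finite set, so that members can be dropped; repetitions and
  trivial members are allowed.
\<close>

definition spans :: "('a, 'b) monoid_scheme \<Rightarrow> 'i set \<Rightarrow> ('i \<Rightarrow> 'a) \<Rightarrow> bool"
  where "spans G I g \<longleftrightarrow>
    finite I \<and> g \<in> I \<rightarrow> carrier G \<and> (\<forall>x\<in>carrier G. \<exists>a. x = pow_prod G I g a)"

context comm_group
begin

lemma pow_prod_closed: "g \<in> I \<rightarrow> carrier G \<Longrightarrow> pow_prod G I g a \<in> carrier G"
  unfolding pow_prod_def by (intro finprod_closed) auto

lemma pow_prod_cong:
  "g \<in> I \<rightarrow> carrier G \<Longrightarrow> (\<And>i. i \<in> I \<Longrightarrow> a i = b i) \<Longrightarrow> pow_prod G I g a = pow_prod G I g b"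
  unfolding pow_prod_def by (intro finprod_cong') auto

lemma pow_prod_add:
  assumes "g \<in> I \<rightarrow> carrier G"
  shows "pow_prod G I g (\<lambda>i. a i + b i) = pow_prod G I g a \<otimes> pow_prod G I g b"
proof -
  have "pow_prod G I g (\<lambda>i. a i + b i) = finprod G (\<lambda>i. g i [^] a i \<otimes> g i [^] b i) I"
    unfolding pow_prod_def using assms by (intro finprod_cong') (auto simp: int_pow_mult Pi_iff)
  also have "\<dots> = pow_prod G I g a \<otimes> pow_prod G I g b"
    unfolding pow_prod_def using assms by (intro finprod_multf) auto
  finally show ?thesis .
qed

lemma pow_prod_remove:
  assumes "finite I" "g \<in> I \<rightarrow> carrier G" "i \<in> I"
  shows "pow_prod G I g a = g i [^] a i \<otimes> pow_prod G (I - {i}) g a"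
proof -
  have "pow_prod G (insert i (I - {i})) g a = g i [^] a i \<otimes> pow_prod G (I - {i}) g a"
    unfolding pow_prod_def using assms by (intro finprod_insert) auto
  thus ?thesis using assms(3) by (simp add: insert_absorb)
qed

lemma spans_reindex:
  assumes "spans G I g" "bij_betw h J I"
  shows "spans G J (g \<circ> h)"
proof -
  have I: "I = h ` J" and inj: "inj_on h J" using assms(2) by (auto simp: bij_betw_def)
  have g: "g \<in> h ` J \<rightarrow> carrier G" using assms(1) I by (simp add: spans_def)
  have "pow_prod G I g a = pow_prod G J (g \<circ> h) (a \<circ> h)" for a
    unfolding pow_prod_def I using g inj by (subst finprod_reindex) auto
  moreover have "finite J"
    using assms by (simp add: spans_def bij_betw_finite)
  ultimately show ?thesis
    using assms(1) I unfolding spans_def Pi_iff by (metis comp_apply imageI)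
qed

lemma spans_if_generate:
  assumes "finite C" "C \<subseteq> carrier G" "generate G C = carrier G"
  shows "spans G C (\<lambda>c. c)"
proof -
  have C: "(\<lambda>c. c) \<in> C \<rightarrow> carrier G" using assms(2) by auto
  have "\<exists>a. x = pow_prod G C (\<lambda>c. c) a" if "x \<in> generate G C" for x
    using that
  proof induction
    case one
    have "\<one> = pow_prod G C (\<lambda>c. c) (\<lambda>_. 0)" by (simp add: pow_prod_def)
    thus ?case by blast
  next
    have single: "c [^] k = pow_prod G C (\<lambda>c. c) (\<lambda>d. if d = c then k else 0)"
      if "c \<in> C" for c and k :: int
    proof -
      have "pow_prod G (C - {c}) (\<lambda>c. c) (\<lambda>d. if d = c then k else 0) = \<one>"
        unfolding pow_prod_def by (intro finprod_one_eqI) auto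
      thus ?thesis
        using that assms C by (subst pow_prod_remove[OF _ _ that]) auto
    qed
    {
      case (incl h)
      thus ?case using single[of h 1] assms(2) by (metis int_pow_1 subsetD)
    next
      case (inv h)
      thus ?case using single[of h "-1"] assms(2) by (metis int_pow_1 int_pow_neg subsetD)
    }
  next
    case (eng x y)
    thus ?case using pow_prod_add[OF C] by metis
  qed
  thus ?thesis using assms C by (simp add: spans_def)
qed

text \<open>
  An elementary row operation: multiplying \<open>g j\<close> by a power of \<open>g i\<close> is compensated by one
  change in the exponent of \<open>g i\<close>. Because the correction of the exponents is the same for every
  \<open>a\<close>, this also shows that the new family spans whatever the old one spans.
\<close>

lemma pow_prod_change_basis:
  fixes s :: int
  assumes "finite I" "g \<in> I \<rightarrow> carrier G" "i \<in> I" "j \<in> I" "i \<noteq> j"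
  shows "pow_prod G I (g(j := g j \<otimes> g i [^] s)) (a(i := a i - s * a j)) = pow_prod G I g a"
proof -
  let ?g = "g(j := g j \<otimes> g i [^] s)" and ?a = "a(i := a i - s * a j)"
  define P where "P = pow_prod G (I - {i} - {j}) g a"
  have gi: "g i \<in> carrier G" and gj: "g j \<in> carrier G" using assms by auto
  have P: "P \<in> carrier G" unfolding P_def using assms by (intro pow_prod_closed) auto
  have g: "?g \<in> I \<rightarrow> carrier G" using assms by (auto simp: Pi_iff)
  have two: "pow_prod G I h b = h i [^] b i \<otimes> (h j [^] b j \<otimes> pow_prod G (I - {i} - {j}) h b)"
    if "h \<in> I \<rightarrow> carrier G" for h b
  proof -
    have "h \<in> I - {i} \<rightarrow> carrier G" using that by auto
    thus ?thesis
      using pow_prod_remove[OF assms(1) that assms(3), of b]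
        pow_prod_remove[of "I - {i}" h j b] assms by simp
  qed
  have "pow_prod G (I - {i} - {j}) ?g ?a = P"
    unfolding P_def pow_prod_def using assms by (intro finprod_cong') (auto simp: Pi_iff)
  hence "pow_prod G I ?g ?a =
      g i [^] (a i - s * a j) \<otimes> ((g j \<otimes> g i [^] s) [^] a j \<otimes> P)"
    using two[OF g, of ?a] assms(5) by simp
  also have "\<dots> = (g i [^] (a i - s * a j) \<otimes> g i [^] (s * a j)) \<otimes> (g j [^] a j \<otimes> P)"
    using gi gj P by (simp add: int_pow_distrib int_pow_pow m_ac)
  also have "\<dots> = g i [^] a i \<otimes> (g j [^] a j \<otimes> P)"
    using gi by (simp flip: int_pow_mult)
  also have "\<dots> = pow_prod G I g a"
    unfolding P_def by (rule two[OF assms(2), symmetric])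
  finally show ?thesis .
qed

text \<open>
  Euclid's algorithm on the exponents of a relation. If two exponents are non-zero, a change of
  family subtracts the smaller from the larger in absolute value, leaving the smaller one non-zero,
  so the induction applies to the new family and relation. If only one exponent is non-zero,
  torsion-freeness forces its generator to be trivial; that generator could be dropped, against
  minimality.
\<close>

lemma minimal_spans_independent:
  fixes I :: "'i set"
  assumes tf: "\<And>x k. x \<in> carrier G \<Longrightarrow> 0 < k \<Longrightarrow> x [^] (k::nat) = \<one> \<Longrightarrow> x = \<one>"
    and min: "\<And>J :: 'i set. \<And>h. spans G J h \<Longrightarrow> card I \<le> card J"
    and "spans G I g" "pow_prod G I g a = \<one>" "i \<in> I"
  shows "a i = 0"
  using assms(3-)
proof (induction "\<Sum>i\<in>I. nat \<bar>a i\<bar>" arbitrary: g a i rule: less_induct)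
  case less
  have fin: "finite I" and g: "g \<in> I \<rightarrow> carrier G" using less.prems by (auto simp: spans_def)
  have tf_int: "x = \<one>" if "x \<in> carrier G" "k \<noteq> 0" "x [^] k = \<one>" for x and k :: int
  proof -
    obtain n where n: "k = int n \<or> k = - int n" by (metis int_cases2)
    have "x [^] n = \<one>"
      using n that(1,3) int_pow_neg_int[OF that(1), of n] inv_eq_1_iff[of "x [^] n"]
      by (auto simp: int_pow_int)
    moreover have "0 < n" using n that(2) by auto
    ultimately show ?thesis using tf that(1) by blast
  qed
  show ?case
  proof (rule ccontr)
    assume ai: "a i \<noteq> 0"
    show False
    proof (cases "\<exists>j\<in>I. j \<noteq> i \<and> a j \<noteq> 0")
      case True
      obtain i j where ij: "i \<in> I" "j \<in> I" "i \<noteq> j" "a j \<noteq> 0" "\<bar>a j\<bar> \<le> \<bar>a i\<bar>"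
      proof -
        from True obtain j where j: "j \<in> I" "j \<noteq> i" "a j \<noteq> 0" by blast
        show thesis
        proof (cases "\<bar>a j\<bar> \<le> \<bar>a i\<bar>")
          case True
          show thesis by (rule that[of i j]) (use True j less.prems(3) in blast)+
        next
          case False
          hence "\<bar>a i\<bar> \<le> \<bar>a j\<bar>" by simp
          show thesis by (rule that[of j i]) (fact | use j(2) in blast)+
        qed
      qed
      \<comment> \<open>The sign for which subtracting \<open>s * a j\<close> brings \<open>a i\<close> closer to zero.\<close>
      define s where "s = sgn (a i) * sgn (a j)"
      let ?g = "g(j := g j \<otimes> g i [^] s)" and ?a = "a(i := a i - s * a j)"
      have "\<bar>a i - s * a j\<bar> < \<bar>a i\<bar>"
        using ij(4,5) unfolding s_def
        by (cases "a i" "0::int" rule: linorder_cases; cases "a j" "0::int" rule: linorder_cases) auto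
      hence "(\<Sum>i\<in>I. nat \<bar>?a i\<bar>) < (\<Sum>i\<in>I. nat \<bar>a i\<bar>)"
        using fin ij(1) by (intro sum_strict_mono_ex1) (auto intro!: bexI[of _ i])
      moreover have "spans G I ?g"
        unfolding spans_def
      proof (intro conjI ballI fin)
        show "?g \<in> I \<rightarrow> carrier G" using g ij by (auto simp: Pi_iff)
        fix x assume "x \<in> carrier G"
        then obtain b where "x = pow_prod G I g b" using less.prems(1) by (auto simp: spans_def)
        thus "\<exists>b. x = pow_prod G I ?g b"
          using pow_prod_change_basis[OF fin g ij(1-3), of s b] by metis
      qed
      moreover have "pow_prod G I ?g ?a = \<one>"
        using pow_prod_change_basis[OF fin g ij(1-3), of s a] less.prems(2) by simp
      ultimately have "?a j = 0" using ij(2) by (rule less.hyps)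
      thus False using ij by simp
    next
      case False
      have gi: "g i \<in> carrier G" using g less.prems(3) by auto
      have rest: "pow_prod G (I - {i}) g b = \<one>" if "\<And>j. j \<in> I - {i} \<Longrightarrow> b j = 0" for b
        unfolding pow_prod_def using that by (intro finprod_one_eqI) auto
      have "g i [^] a i = \<one>"
      proof -
        have "pow_prod G (I - {i}) g a = \<one>" using False by (intro rest) blast
        thus ?thesis
          using less.prems(2) gi pow_prod_remove[OF fin g less.prems(3), of a] by simp
      qed
      hence one: "g i = \<one>" using tf_int gi ai by blast
      have "pow_prod G I g b = pow_prod G (I - {i}) g b" for b
        using g pow_prod_remove[OF fin g less.prems(3), of b] pow_prod_closed[of g "I - {i}" b]
        by (simp add: one Pi_iff)
      hence "spans G (I - {i}) g"
        using less.prems(1) by (auto simp: spans_def)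
      hence "card I \<le> card (I - {i})" by (rule min)
      thus False using fin less.prems(3) by (meson card_Diff1_less not_less)
    qed
  qed
qed

text \<open>
  A spanning family of least cardinality is a basis, and its exponent vectors give the isomorphism.
\<close>

lemma fin_gen_torsion_free_imp_free:
  assumes "finite C" "C \<subseteq> carrier G" "generate G C = carrier G"
    and tf: "\<And>x k. x \<in> carrier G \<Longrightarrow> 0 < k \<Longrightarrow> x [^] (k::nat) = \<one> \<Longrightarrow> x = \<one>"
  shows "\<exists>n. G \<cong> free_abelian_rank n"
proof -
  define n where "n = (LEAST n. \<exists>g. spans G {..<n::nat} g)"
  obtain h :: "nat \<Rightarrow> 'a" where h: "bij_betw h {..<card C} C"
    using assms(1) by (metis lessThan_atLeast0 ex_bij_betw_nat_finite)
  have ex: "\<exists>g. spans G {..<card C} g"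
    using spans_reindex[OF spans_if_generate[OF assms(1-3)] h] by blast
  obtain g where g: "spans G {..<n} g"
    using LeastI_ex[of "\<lambda>n. \<exists>g. spans G {..<n} g"] ex unfolding n_def by blast
  have min: "card {..<n} \<le> card J" if J: "spans G J k" for J :: "nat set" and k
  proof -
    obtain h where "bij_betw h {..<card J} J"
      using J by (metis lessThan_atLeast0 ex_bij_betw_nat_finite spans_def)
    from spans_reindex[OF J this] have "n \<le> card J"
      unfolding n_def by (intro Least_le) blast
    thus ?thesis by simp
  qed
  have gc: "g \<in> {..<n} \<rightarrow> carrier G" using g by (simp add: spans_def)
  have grp: "group (free_abelian_rank n)" by (simp add: free_abelian_rank_def)
  have car: "carrier (free_abelian_rank n) = {..<n} \<rightarrow>\<^sub>E UNIV"
    by (simp add: free_abelian_rank_def)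
  have "pow_prod G {..<n} g \<in> hom (free_abelian_rank n) G"
  proof (rule homI)
    fix a b :: "nat \<Rightarrow> int"
    show "pow_prod G {..<n} g (a \<otimes>\<^bsub>free_abelian_rank n\<^esub> b) =
        pow_prod G {..<n} g a \<otimes> pow_prod G {..<n} g b"
      unfolding pow_prod_add[OF gc, symmetric]
      by (rule pow_prod_cong[OF gc]) (simp add: free_abelian_rank_def)
  qed (rule pow_prod_closed[OF gc])
  then interpret f: group_hom "free_abelian_rank n" G "pow_prod G {..<n} g"
    by (simp add: group_hom_def group_hom_axioms_def grp group_axioms)
  have "pow_prod G {..<n} g \<in> iso (free_abelian_rank n) G"
    unfolding f.iso_iff
  proof (intro conjI subsetI ballI impI)
    fix x assume "x \<in> carrier G"
    then obtain a where "x = pow_prod G {..<n} g a" using g by (auto simp: spans_def)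
    also have "\<dots> = pow_prod G {..<n} g (restrict a {..<n})"
      by (rule pow_prod_cong[OF gc]) simp
    finally show "x \<in> pow_prod G {..<n} g ` carrier (free_abelian_rank n)"
      unfolding car by (rule image_eqI[where x = "restrict a {..<n}"]) simp
  next
    fix a assume a: "a \<in> carrier (free_abelian_rank n)" "pow_prod G {..<n} g a = \<one>"
    have "a i = 0" if "i < n" for i
      using minimal_spans_independent[OF tf min g a(2)] that by simp
    thus "a = \<one>\<^bsub>free_abelian_rank n\<^esub>"
      using a(1) unfolding car by (auto simp: free_abelian_rank_def PiE_iff extensional_def)
  qed
  thus ?thesis
    using group.iso_sym[OF grp] unfolding is_iso_def by blast
qed

end

section \<open>Conjugacy classes and elements with finitely many conjugates\<close>

context group
begin

lemma mult_inv_cancel: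
  assumes "g \<in> carrier G" "z \<in> carrier G"
  shows "g \<otimes> (inv g \<otimes> z) = z" "inv g \<otimes> (g \<otimes> z) = z"
  using assms by (simp_all flip: m_assoc)

lemma conj_mult:
  assumes "x \<in> carrier G" "y \<in> carrier G" "g \<in> carrier G"
  shows "inv g \<otimes> (x \<otimes> y) \<otimes> g = (inv g \<otimes> x \<otimes> g) \<otimes> (inv g \<otimes> y \<otimes> g)"
  using assms by (simp add: m_assoc mult_inv_cancel)

lemma conj_pow:
  assumes "x \<in> carrier G" "g \<in> carrier G"
  shows "inv g \<otimes> x [^] (n::nat) \<otimes> g = (inv g \<otimes> x \<otimes> g) [^] n"
  by (induction n) (use assms conj_mult in simp_all)

lemma conj_conj:
  assumes "x \<in> carrier G" "g \<in> carrier G" "h \<in> carrier G"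
  shows "inv h \<otimes> (inv g \<otimes> x \<otimes> g) \<otimes> h = inv (g \<otimes> h) \<otimes> x \<otimes> (g \<otimes> h)"
  using assms by (simp add: inv_mult_group m_assoc)

lemma conj_class_self: "x \<in> carrier G \<Longrightarrow> x \<in> conj_class G x"
  unfolding conj_class_def by (force intro!: exI[of _ \<one>])

lemma conj_class_subset_carrier: "x \<in> carrier G \<Longrightarrow> conj_class G x \<subseteq> carrier G"
  by (auto simp: conj_class_def)

lemma conj_class_conj_closed:
  assumes "x \<in> carrier G" "g \<in> carrier G" "c \<in> conj_class G x"
  shows "inv g \<otimes> c \<otimes> g \<in> conj_class G x"
  using assms conj_conj[of x _ g] unfolding conj_class_def by blast

lemma conj_class_conj:
  assumes "x \<in> carrier G" "g \<in> carrier G"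
  shows "conj_class G (inv g \<otimes> x \<otimes> g) \<subseteq> conj_class G x"
  using assms conj_conj[of x g] by (auto simp: conj_class_def)

lemma conj_class_pow:
  assumes "x \<in> carrier G"
  shows "conj_class G (x [^] (n::nat)) = (\<lambda>c. c [^] n) ` conj_class G x"
proof -
  have "conj_class G y = (\<lambda>g. inv g \<otimes> y \<otimes> g) ` carrier G" for y
    by (auto simp: conj_class_def)
  thus ?thesis using conj_pow[OF assms, of _ n] by (simp add: image_image)
qed

lemma FC_conj:
  assumes "x \<in> FC G" "g \<in> carrier G"
  shows "inv g \<otimes> x \<otimes> g \<in> FC G"
  using assms conj_class_conj[of x g] by (auto simp: FC_def intro: finite_subset)

lemma FC_normal: "FC G \<lhd> G"
proof (rule normal_invI)
  show "g \<otimes> x \<otimes> inv g \<in> FC G" if "g \<in> carrier G" "x \<in> FC G" for g x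
    using FC_conj[of x "inv g"] that by simp
qed (rule subgroup_FC[OF group_axioms])

lemma conj_class_generate_normal:
  assumes "x \<in> carrier G"
  shows "generate G (conj_class G x) \<lhd> G"
proof (rule normal_generateI)
  show "g \<otimes> c \<otimes> inv g \<in> conj_class G x" if "c \<in> conj_class G x" "g \<in> carrier G" for c g
    using conj_class_conj_closed[OF assms, of "inv g"] that by simp
qed (rule conj_class_subset_carrier[OF assms])

lemma conj_class_subset_normal:
  assumes "K \<lhd> G" "x \<in> K"
  shows "conj_class G x \<subseteq> K"
  using normal.inv_op_closed1[OF assms(1) _ assms(2)] by (auto simp: conj_class_def)

end

section \<open>Finite sets of torsion elements: Dietzmann's lemma\<close>

context group
begin

definition word_prod :: "'a list \<Rightarrow> 'a"
  where "word_prod ws = foldr (\<otimes>) ws \<one>"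

lemma word_prod_closed: "set ws \<subseteq> carrier G \<Longrightarrow> word_prod ws \<in> carrier G"
  by (induction ws) (auto simp: word_prod_def)

lemma word_prod_append:
  assumes "set us \<subseteq> carrier G" "set ws \<subseteq> carrier G"
  shows "word_prod (us @ ws) = word_prod us \<otimes> word_prod ws"
  using assms(1)
proof (induction us)
  case Nil
  thus ?case using word_prod_closed[OF assms(2)] by (simp add: word_prod_def)
next
  case (Cons u us)
  thus ?case
    using word_prod_closed[OF assms(2)] word_prod_closed[of us]
    by (simp add: word_prod_def m_assoc)
qed

lemma word_prod_replicate: "c \<in> carrier G \<Longrightarrow> word_prod (replicate n c) = c [^] n"
  by (induction n) (simp_all add: word_prod_def flip: nat_pow_Suc2)

text \<open>
  Moving a letter \<open>c\<close> to the front past a letter \<open>w\<close> replaces \<open>w\<close> by a conjugate, which is again a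
  letter as \<open>C\<close> is closed under conjugation. The length of the word does not change.
\<close>

lemma word_collect:
  assumes C: "C \<subseteq> carrier G"
    and normal: "\<And>g c. g \<in> carrier G \<Longrightarrow> c \<in> C \<Longrightarrow> inv g \<otimes> c \<otimes> g \<in> C"
    and c: "c \<in> C" and "set ws \<subseteq> C"
  shows "\<exists>us. set us \<subseteq> C \<and> length us + count_list ws c = length ws \<and>
    word_prod ws = c [^] count_list ws c \<otimes> word_prod us"
  using assms(4)
proof (induction ws)
  case Nil
  thus ?case by (intro exI[of _ "[]"]) (simp add: word_prod_def)
next
  case (Cons w ws)
  define j where "j = count_list ws c"
  obtain us where us: "set us \<subseteq> C" "length us + j = length ws"
      "word_prod ws = c [^] j \<otimes> word_prod us"
    using Cons unfolding j_def by auto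
  have cc: "c \<in> carrier G" and wc: "w \<in> carrier G" using C c Cons.prems by auto
  have uc: "word_prod us \<in> carrier G" using us(1) C by (intro word_prod_closed) auto
  have step: "word_prod (w # ws) = w \<otimes> (c [^] j \<otimes> word_prod us)"
    using us(3) by (simp add: word_prod_def)
  show ?case
  proof (cases "w = c")
    case True
    have "word_prod (w # ws) = (c \<otimes> c [^] j) \<otimes> word_prod us"
      unfolding step using True cc uc by (simp add: m_assoc)
    also have "c \<otimes> c [^] j = c [^] Suc j" using cc by (simp only: nat_pow_Suc2)
    finally show ?thesis
      using True us(1,2) j_def by (intro exI[of _ us]) simp
  next
    case False
    define v where "v = inv (c [^] j) \<otimes> w \<otimes> c [^] j"
    have v: "v \<in> C" unfolding v_def using cc Cons.prems by (intro normal) auto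
    have vc: "v \<in> carrier G" using v C by blast
    have swap: "w \<otimes> c [^] j = c [^] j \<otimes> v"
      unfolding v_def using cc wc by (simp add: m_assoc mult_inv_cancel)
    have "word_prod (w # ws) = (w \<otimes> c [^] j) \<otimes> word_prod us"
      unfolding step using cc wc uc by (simp add: m_assoc)
    also have "\<dots> = c [^] j \<otimes> word_prod (v # us)"
      unfolding swap using cc vc uc by (simp add: m_assoc word_prod_def)
    finally have "word_prod (w # ws) = c [^] j \<otimes> word_prod (v # us)" .
    thus ?thesis
      using False us(1,2) v j_def by (intro exI[of _ "v # us"]) simp
  qed
qed

text \<open>
  In a word with more than \<open>card C * m\<close> letters some letter occurs at least \<open>m\<close> times. Once its
  occurrences are collected at the front, \<open>m\<close> of them multiply to the identity and can be deleted.
\<close>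

lemma word_shorten:
  assumes C: "C \<subseteq> carrier G"
    and normal: "\<And>g c. g \<in> carrier G \<Longrightarrow> c \<in> C \<Longrightarrow> inv g \<otimes> c \<otimes> g \<in> C"
    and fin: "finite C" and m: "0 < m" and torsion: "\<And>c. c \<in> C \<Longrightarrow> c [^] (m::nat) = \<one>"
    and "set ws \<subseteq> C"
  shows "\<exists>us. set us \<subseteq> C \<and> length us \<le> card C * m \<and> word_prod us = word_prod ws"
  using assms(6)
proof (induction "length ws" arbitrary: ws rule: less_induct)
  case less
  show ?case
  proof (cases "length ws \<le> card C * m")
    case True
    thus ?thesis using less.prems by blast
  next
    case False
    have "\<exists>c\<in>C. m \<le> count_list ws c"
    proof (rule ccontr)
      assume "\<not> ?thesis"
      hence "(\<Sum>c\<in>C. count_list ws c) \<le> (\<Sum>c\<in>C. m)" by (intro sum_mono) (auto simp: not_le)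
      moreover have "(\<Sum>c\<in>C. count_list ws c) = length ws"
        using sum_count_set[OF less.prems fin] .
      ultimately show False using False by simp
    qed
    then obtain c where c: "c \<in> C" "m \<le> count_list ws c" by blast
    obtain us where us: "set us \<subseteq> C" "length us + count_list ws c = length ws"
        "word_prod ws = c [^] count_list ws c \<otimes> word_prod us"
      using word_collect[OF C normal c(1) less.prems] by blast
    define vs where "vs = replicate (count_list ws c - m) c @ us"
    have cc: "c \<in> carrier G" using c C by auto
    have "c [^] count_list ws c = c [^] (count_list ws c - m) \<otimes> c [^] m"
      using cc c(2) by (simp add: nat_pow_mult)
    hence "c [^] count_list ws c = c [^] (count_list ws c - m)"
      using torsion[OF c(1)] cc by simp
    hence "word_prod vs = word_prod ws"
      using us(1) C cc c(1) unfolding vs_def us(3)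
      by (subst word_prod_append) (auto simp: word_prod_replicate)
    moreover have vs: "set vs \<subseteq> C" using us(1) c(1) by (auto simp: vs_def)
    moreover have "length vs < length ws"
      using us(2) m c(2) by (simp add: vs_def)
    ultimately show ?thesis using less.hyps[of vs] by auto
  qed
qed

text \<open>
  By torsion the inverses of letters are words too, so every element of the generated subgroup is
  the product of a word; short words suffice, and there are finitely many of them.
\<close>

lemma dietzmann:
  assumes C: "C \<subseteq> carrier G"
    and normal: "\<And>g c. g \<in> carrier G \<Longrightarrow> c \<in> C \<Longrightarrow> inv g \<otimes> c \<otimes> g \<in> C"
    and fin: "finite C" and m: "0 < m" and torsion: "\<And>c. c \<in> C \<Longrightarrow> c [^] (m::nat) = \<one>"
  shows "finite (generate G C)"
proof -
  have words: "\<exists>ws. set ws \<subseteq> C \<and> x = word_prod ws" if "x \<in> generate G C" for x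
    using that
  proof induction
    case one
    show ?case by (intro exI[of _ "[]"]) (simp add: word_prod_def)
  next
    case (incl c)
    thus ?case using C by (intro exI[of _ "[c]"]) (auto simp: word_prod_def)
  next
    case (inv c)
    hence cc: "c \<in> carrier G" using C by auto
    have "c \<otimes> c [^] (m - 1) = \<one>"
      using torsion[OF inv] m cc nat_pow_Suc2[of c "m - 1"] by simp
    hence "inv c = c [^] (m - 1)" using cc by (metis inv_equality inv_inv inv_closed nat_pow_closed)
    thus ?case
      using inv cc by (intro exI[of _ "replicate (m - 1) c"]) (auto simp: word_prod_replicate)
  next
    case (eng x y)
    then obtain us ws where "set us \<subseteq> C" "x = word_prod us" "set ws \<subseteq> C" "y = word_prod ws"
      by blast
    moreover from this have "word_prod (us @ ws) = word_prod us \<otimes> word_prod ws"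
      using C by (intro word_prod_append) auto
    ultimately show ?case by (intro exI[of _ "us @ ws"]) simp
  qed
  have "generate G C \<subseteq> word_prod ` {ws. set ws \<subseteq> C \<and> length ws \<le> card C * m}"
  proof (intro subsetI)
    fix x assume "x \<in> generate G C"
    then obtain ws where "set ws \<subseteq> C" "x = word_prod ws"
      using words by blast
    moreover from word_shorten[OF C normal fin m torsion this(1)]
    obtain us where "set us \<subseteq> C" "length us \<le> card C * m" "word_prod us = word_prod ws" by blast
    ultimately show "x \<in> word_prod ` {ws. set ws \<subseteq> C \<and> length ws \<le> card C * m}"
      by (intro image_eqI[where x = us]) auto
  qed
  thus ?thesis
    using finite_lists_length_le[OF fin] by (rule finite_subset[OF _ finite_imageI])
qed

lemma finite_normal_subgroup_if_torsion:
  assumes "x \<in> FC G" "0 < m" "x [^] (m::nat) = \<one>"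
  shows "finite (generate G (conj_class G x))"
proof (rule dietzmann)
  have x: "x \<in> carrier G" and fin: "finite (conj_class G x)" using assms(1) by (auto simp: FC_def)
  show "finite (conj_class G x)" by fact
  show "conj_class G x \<subseteq> carrier G" using x by (rule conj_class_subset_carrier)
  show "inv g \<otimes> c \<otimes> g \<in> conj_class G x" if "g \<in> carrier G" "c \<in> conj_class G x" for g c
    using conj_class_conj_closed[OF x that] .
  show "c [^] m = \<one>" if c: "c \<in> conj_class G x" for c
    using c assms(3) conj_pow[OF x, of _ m] by (auto simp: conj_class_def)
qed fact

end

section \<open>Commuting powers of conjugates\<close>

context group
begin

text \<open>
  Centralizers are subgroups, so the commutation with \<open>C\<close> extends to the generated subgroup, first
  in one argument and then in the other.
\<close>

lemma generate_commuting:
  assumes C: "C \<subseteq> carrier G" and comm: "\<And>x y. x \<in> C \<Longrightarrow> y \<in> C \<Longrightarrow> x \<otimes> y = y \<otimes> x"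
    and "x \<in> generate G C" "y \<in> generate G C"
  shows "x \<otimes> y = y \<otimes> x"
proof -
  have inv_comm: "inv a \<otimes> d = d \<otimes> inv a"
    if "a \<otimes> d = d \<otimes> a" "a \<in> carrier G" "d \<in> carrier G" for a d
  proof -
    have "inv a \<otimes> d = inv a \<otimes> (d \<otimes> a) \<otimes> inv a" using that(2,3) by (simp add: m_assoc)
    also have "\<dots> = d \<otimes> inv a" using that(2,3) by (simp flip: that(1) add: mult_inv_cancel)
    finally show ?thesis .
  qed
  have mult_comm: "(a \<otimes> b) \<otimes> d = d \<otimes> (a \<otimes> b)"
    if "a \<otimes> d = d \<otimes> a" "b \<otimes> d = d \<otimes> b" "a \<in> carrier G" "b \<in> carrier G" "d \<in> carrier G"
    for a b d
    using that by (metis m_assoc)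
  have cent: "subgroup {z \<in> carrier G. \<forall>d\<in>D. z \<otimes> d = d \<otimes> z} G" if D: "D \<subseteq> carrier G" for D
  proof (rule subgroupI)
    show "{z \<in> carrier G. \<forall>d\<in>D. z \<otimes> d = d \<otimes> z} \<noteq> {}"
      using D by (auto intro!: exI[of _ \<one>])
  next
    fix a assume "a \<in> {z \<in> carrier G. \<forall>d\<in>D. z \<otimes> d = d \<otimes> z}"
    thus "inv a \<in> {z \<in> carrier G. \<forall>d\<in>D. z \<otimes> d = d \<otimes> z}"
      using D inv_comm[of a] by (simp add: subset_iff)
  next
    fix a b assume "a \<in> {z \<in> carrier G. \<forall>d\<in>D. z \<otimes> d = d \<otimes> z}"
      "b \<in> {z \<in> carrier G. \<forall>d\<in>D. z \<otimes> d = d \<otimes> z}"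
    thus "a \<otimes> b \<in> {z \<in> carrier G. \<forall>d\<in>D. z \<otimes> d = d \<otimes> z}"
      using D mult_comm[of a _ b] by (simp add: subset_iff)
  qed auto
  have "generate G C \<subseteq> {z \<in> carrier G. \<forall>d\<in>C. z \<otimes> d = d \<otimes> z}"
    using C comm by (intro generate_subgroup_incl[OF _ cent]) auto
  hence "C \<subseteq> {z \<in> carrier G. \<forall>d\<in>generate G C. z \<otimes> d = d \<otimes> z}"
    using C by auto
  hence "generate G C \<subseteq> {z \<in> carrier G. \<forall>d\<in>generate G C. z \<otimes> d = d \<otimes> z}"
    using generate_incl[OF C] by (intro generate_subgroup_incl[OF _ cent]) auto
  thus ?thesis using assms(3,4) by blast
qed

lemma pow_comm:
  assumes "u \<otimes> z = z \<otimes> u" "u \<in> carrier G" "z \<in> carrier G"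
  shows "u [^] (k::nat) \<otimes> z = z \<otimes> u [^] k"
proof (induction k)
  case (Suc k)
  thus ?case using assms by (simp add: m_assoc) (simp flip: m_assoc)
qed (use assms in simp)

text \<open>
  For a single \<open>y\<close> with finite class, two of the conjugates of \<open>y\<close> by \<open>x\<^sup>0, x\<^sup>1, x\<^sup>2, \<dots>\<close> agree, so the
  quotient of the two powers of \<open>x\<close> centralizes \<open>y\<close>. The product of the exponents obtained for the
  finitely many \<open>y\<close> works for all of them.
\<close>

lemma pow_centralizes_FC:
  assumes x: "x \<in> carrier G" and "finite C" "C \<subseteq> FC G"
  shows "\<exists>m::nat. 0 < m \<and> (\<forall>y\<in>C. x [^] m \<otimes> y = y \<otimes> x [^] m)"
  using assms(2,3)
proof (induction C rule: finite_induct)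
  case empty
  show ?case by (auto intro: exI[of _ 1])
next
  case (insert y C)
  then obtain m :: nat where m: "0 < m" "\<And>z. z \<in> C \<Longrightarrow> x [^] m \<otimes> z = z \<otimes> x [^] m" by auto
  have y: "y \<in> carrier G" "finite (conj_class G y)" using insert.prems by (auto simp: FC_def)
  define f where "f k = inv (x [^] k) \<otimes> y \<otimes> x [^] k" for k :: nat
  have "finite (range f)"
    using y(2) x by (rule_tac finite_subset) (auto simp: f_def conj_class_def)
  hence "\<not> inj f" using finite_imageD infinite_UNIV_nat by blast
  then obtain k l where kl: "f k = f l" "k < l" by (metis injI linorder_neqE_nat)
  define n where "n = l - k"
  have l: "x [^] l = x [^] n \<otimes> x [^] k" using kl(2) x by (simp add: n_def nat_pow_mult)
  have "f k = inv (x [^] k) \<otimes> (inv (x [^] n) \<otimes> y \<otimes> x [^] n) \<otimes> x [^] k"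
    unfolding kl(1) unfolding f_def l using x y(1) by (simp add: conj_conj)
  hence "y = inv (x [^] n) \<otimes> y \<otimes> x [^] n"
    using x y(1) by (simp add: f_def)
  hence "x [^] n \<otimes> y = x [^] n \<otimes> (inv (x [^] n) \<otimes> y \<otimes> x [^] n)" by simp
  hence n: "x [^] n \<otimes> y = y \<otimes> x [^] n"
    using x y(1) by (simp add: m_assoc mult_inv_cancel)
  have "x [^] (m * n) \<otimes> z = z \<otimes> x [^] (m * n)" if "z \<in> insert y C" for z
  proof (cases "z = y")
    case True
    thus ?thesis using pow_comm[OF n, of m] x y by (simp add: nat_pow_pow mult.commute)
  next
    case False
    hence "z \<in> C" "z \<in> carrier G" using that insert.prems by (auto simp: FC_def)
    thus ?thesis using pow_comm[OF m(2), of z n] x by (simp add: nat_pow_pow)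
  qed
  moreover have "0 < m * n" using m kl n_def by simp
  ultimately show ?case by blast
qed

end

text \<open>
  If \<open>x\<^sup>m\<close> centralizes the class of \<open>x\<close>, so does every conjugate of \<open>x\<^sup>m\<close>, since the class is
  invariant under conjugation. The conjugates of \<open>x\<^sup>m\<close> are themselves \<open>m\<close>-th powers of members of
  that class.
\<close>

lemma (in group) conj_class_pow_commute:
  assumes x: "x \<in> carrier G"
    and cent: "\<And>y. y \<in> conj_class G x \<Longrightarrow> x [^] (m::nat) \<otimes> y = y \<otimes> x [^] m"
    and "c \<in> conj_class G (x [^] m)" "d \<in> conj_class G (x [^] m)"
  shows "c \<otimes> d = d \<otimes> c"
proof -
  obtain g where g: "g \<in> carrier G" "c = inv g \<otimes> x [^] m \<otimes> g"
    using assms(3) by (auto simp: conj_class_def)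
  obtain b where b: "b \<in> conj_class G x" "d = b [^] m"
    using assms(4) unfolding conj_class_pow[OF x] by blast
  have bc: "b \<in> carrier G" using b(1) conj_class_subset_carrier[OF x] by blast
  have cc: "c \<in> carrier G" using g x by simp
  define b' where "b' = inv (inv g) \<otimes> b \<otimes> inv g"
  have b': "b' \<in> carrier G" "b = inv g \<otimes> b' \<otimes> g"
    using g(1) bc by (simp_all add: b'_def m_assoc mult_inv_cancel)
  have "b' \<in> conj_class G x"
    unfolding b'_def using g(1) b(1) by (intro conj_class_conj_closed[OF x]) auto
  hence "x [^] m \<otimes> b' = b' \<otimes> x [^] m" by (rule cent)
  hence "b \<otimes> c = c \<otimes> b"
    using g x b' by (simp flip: conj_mult)
  thus ?thesis
    unfolding b(2) using pow_comm[of b c m] bc cc by simp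
qed

lemma (in group) generate_free_if_commuting:
  assumes "finite C" "C \<subseteq> carrier G"
    and "\<And>c d. c \<in> C \<Longrightarrow> d \<in> C \<Longrightarrow> c \<otimes> d = d \<otimes> c"
    and tf: "\<And>x k. x \<in> generate G C \<Longrightarrow> 0 < k \<Longrightarrow> x [^] (k::nat) = \<one> \<Longrightarrow> x = \<one>"
  shows "\<exists>n. G\<lparr>carrier := generate G C\<rparr> \<cong> free_abelian_rank n"
proof -
  let ?N = "generate G C" and ?H = "G\<lparr>carrier := generate G C\<rparr>"
  have sub: "subgroup ?N G" using assms(2) by (rule generate_is_subgroup)
  have CN: "C \<subseteq> ?N" by (auto intro: generate.incl)
  interpret H: group ?H using sub by (rule subgroup_imp_group)
  have "x \<otimes> y = y \<otimes> x" if "x \<in> ?N" "y \<in> ?N" for x y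
    using generate_commuting[OF assms(2,3) that] .
  then interpret H: comm_group ?H by (intro H.group_comm_groupI) simp
  show ?thesis
  proof (rule H.fin_gen_torsion_free_imp_free[OF assms(1)])
    show "C \<subseteq> carrier ?H" using CN by simp
    show "generate ?H C = carrier ?H" using generate_consistent[OF CN sub] by simp
    show "x = \<one>\<^bsub>?H\<^esub>" if "x \<in> carrier ?H" "0 < k" "x [^]\<^bsub>?H\<^esub> k = \<one>\<^bsub>?H\<^esub>" for x and k :: nat
      using tf[of x k] that by (simp flip: nat_pow_consistent)
  qed
qed

section \<open>Normal subgroups witnessing finite conjugacy classes\<close>

text \<open>
  The normal closure of an element \<open>y\<close> of \<open>K \<inter> FC G\<close> lies in \<open>K \<inter> FC G\<close>, and is generated by the
  finite class of \<open>y\<close>. If \<open>y\<close> can be chosen non-trivial of finite order, the closure is finite by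
  Dietzmann's lemma. Otherwise \<open>K \<inter> FC G\<close> is torsion-free, and a power \<open>y = x\<^sup>m\<close> whose conjugates
  commute with each other is still non-trivial; its closure is abelian, finitely generated and
  torsion-free.
\<close>

lemma (in group) normal_subgroup_of_FC_element:
  assumes K: "K \<lhd> G" and x: "x \<in> K" "x \<in> FC G" "x \<noteq> \<one>"
  shows "\<exists>N. N \<lhd> G \<and> N \<subseteq> K \<and> N \<noteq> {\<one>} \<and>
    (finite N \<or> (\<exists>n. G\<lparr>carrier := N\<rparr> \<cong> free_abelian_rank n) \<and> N \<subseteq> FC G)"
proof -
  have generated: "generate G (conj_class G y) \<lhd> G \<and> generate G (conj_class G y) \<subseteq> K \<inter> FC G \<and>
      generate G (conj_class G y) \<noteq> {\<one>}"
    if "y \<in> K" "y \<in> FC G" "y \<noteq> \<one>" for y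
  proof (intro conjI)
    have y: "y \<in> carrier G" using that(2) by (simp add: FC_def)
    show "generate G (conj_class G y) \<lhd> G" using y by (rule conj_class_generate_normal)
    show "generate G (conj_class G y) \<subseteq> K \<inter> FC G"
    proof (rule Int_greatest)
      show "generate G (conj_class G y) \<subseteq> K"
        using conj_class_subset_normal[OF K that(1)] normal_imp_subgroup[OF K]
        by (rule generate_subgroup_incl)
      show "generate G (conj_class G y) \<subseteq> FC G"
        using conj_class_subset_normal[OF FC_normal that(2)] normal_imp_subgroup[OF FC_normal]
        by (rule generate_subgroup_incl)
    qed
    show "generate G (conj_class G y) \<noteq> {\<one>}"
      using generate.incl[OF conj_class_self[OF y]] that(3) by blast
  qed
  show ?thesis
  proof (cases "\<exists>y m. y \<in> K \<and> y \<in> FC G \<and> y \<noteq> \<one> \<and> 0 < m \<and> y [^] (m::nat) = \<one>")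
    case True
    then obtain y m where y: "y \<in> K" "y \<in> FC G" "y \<noteq> \<one>" "0 < m" "y [^] (m::nat) = \<one>" by blast
    have "finite (generate G (conj_class G y))"
      using y(2,4,5) by (rule finite_normal_subgroup_if_torsion)
    thus ?thesis using generated[OF y(1-3)] by blast
  next
    case False
    hence tf: "y = \<one>" if "y \<in> K \<inter> FC G" "0 < m" "y [^] m = \<one>" for y and m :: nat
      using that by blast
    have xc: "x \<in> carrier G" "finite (conj_class G x)" using x(2) by (auto simp: FC_def)
    obtain m :: nat where m: "0 < m"
        "\<And>y. y \<in> conj_class G x \<Longrightarrow> x [^] m \<otimes> y = y \<otimes> x [^] m"
      using pow_centralizes_FC[OF xc conj_class_subset_normal[OF FC_normal x(2)]] by blast
    define y where "y = x [^] m"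
    have "subgroup (K \<inter> FC G) G"
      by (intro subgroups_Inter_pair normal_imp_subgroup K FC_normal)
    hence y: "y \<in> K \<inter> FC G"
      using subgroup_int_pow_closed[of "K \<inter> FC G" x "int m"] x by (simp add: y_def int_pow_int)
    have "y \<noteq> \<one>" using tf[of x m] x m(1) by (auto simp: y_def)
    hence N: "generate G (conj_class G y) \<lhd> G" "generate G (conj_class G y) \<subseteq> K \<inter> FC G"
        "generate G (conj_class G y) \<noteq> {\<one>}"
      using generated[of y] y by blast+
    have "\<exists>n. G\<lparr>carrier := generate G (conj_class G y)\<rparr> \<cong> free_abelian_rank n"
    proof (rule generate_free_if_commuting)
      show "finite (conj_class G y)" using y by (simp add: FC_def)
      show "conj_class G y \<subseteq> carrier G" using xc by (simp add: y_def conj_class_subset_carrier)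
      show "c \<otimes> d = d \<otimes> c" if "c \<in> conj_class G y" "d \<in> conj_class G y" for c d
        by (rule conj_class_pow_commute[OF xc(1) _ that[unfolded y_def]]) (rule m(2))
      show "z = \<one>" if "z \<in> generate G (conj_class G y)" "0 < k" "z [^] k = \<one>" for z and k :: nat
        using tf[of z k] that N(2) by blast
    qed
    thus ?thesis using N by blast
  qed
qed

lemma (in group) not_icc_iff:
  assumes "carrier G \<noteq> {\<one>}"
  shows "\<not> icc G \<longleftrightarrow> (\<exists>x\<in>FC G. x \<noteq> \<one>)"
proof -
  have "conj_class G x = {\<one>} \<longleftrightarrow> x = \<one>" if "x \<in> carrier G" for x
    using conj_class_self[OF that] that by (auto simp: conj_class_def intro!: exI[of _ \<one>])
  thus ?thesis using assms by (auto simp: icc_def FC_def)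
qed

lemma (in normal) orbit_conj_hom: "x \<in> H \<Longrightarrow> orbit G (conj_hom G H) x = conj_class G x"
  by (auto simp: orbit_def conj_hom_def conj_class_def)

section \<open>Split extensions\<close>

text \<open>
  The data of a split extension as a locale, so that the calculus of the normal subgroup \<open>K\<close> is
  available inside it.
\<close>

locale split_ext =
  fixes G :: "('a, 'b) monoid_scheme" (structure) and K Q :: "'a set" and \<theta> :: "'a \<Rightarrow> 'a \<Rightarrow> 'a"
  assumes split: "split_extension G K Q \<theta>"
begin

sublocale normal K G
  using split by (simp add: split_extension_def)

lemma Q: "subgroup Q G" and disjoint: "K \<inter> Q = {\<one>}"
  and theta_hom: "\<theta> \<in> hom (G\<lparr>carrier := Q\<rparr>) (Aut (G\<lparr>carrier := K\<rparr>))"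
  and theta_eq: "q \<in> Q \<Longrightarrow> k \<in> K \<Longrightarrow> \<theta> q k = inv q \<otimes> k \<otimes> q"
  using split by (auto simp: split_extension_def)

lemma Q_closed: "q \<in> Q \<Longrightarrow> q \<in> carrier G"
  using subgroup.mem_carrier[OF Q] .

lemma decompose:
  assumes "x \<in> carrier G"
  obtains a b where "a \<in> K" "b \<in> Q" "x = a \<otimes> b"
proof -
  have "x \<in> K <#> Q" using split assms by (simp add: split_extension_def)
  thus thesis using that by (auto simp: set_mult_def)
qed

lemma mult_inv_inj:
  assumes "u \<in> Q" "u' \<in> Q" "v \<in> K" "v' \<in> K" "u \<otimes> inv v = u' \<otimes> inv v'"
  shows "u = u' \<and> v = v'"
proof -
  note carrier = Q_closed[OF assms(1)] Q_closed[OF assms(2)] mem_carrier[OF assms(3)]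
    mem_carrier[OF assms(4)]
  have "inv u' \<otimes> u = inv u' \<otimes> (u \<otimes> inv v) \<otimes> v" using carrier by (simp add: m_assoc)
  also have "\<dots> = inv v' \<otimes> v" unfolding assms(5) using carrier by (simp add: m_assoc mult_inv_cancel)
  finally have eq: "inv u' \<otimes> u = inv v' \<otimes> v" .
  have "inv u' \<otimes> u \<in> Q" using assms(1,2) Q by (simp add: subgroup.m_closed subgroup.m_inv_closed)
  moreover have "inv v' \<otimes> v \<in> K" using assms(3,4) by simp
  ultimately have "inv u' \<otimes> u = \<one>" "inv v' \<otimes> v = \<one>" using disjoint eq by auto
  thus ?thesis using carrier by (metis inv_comm inv_equality inv_inv inv_closed)
qed

text \<open>
  The hypothesis says that \<open>z = q k\<^sup>-\<^sup>1\<close> centralizes \<open>K\<close>. Hence its conjugates by \<open>K Q\<close> are those by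
  \<open>Q\<close>, and conjugation by \<open>b \<in> Q\<close> turns \<open>z\<close> into \<open>u v\<^sup>-\<^sup>1\<close> with \<open>u = b\<^sup>-\<^sup>1 q b\<close> and
  \<open>v = \<theta>\<^sub>b(k)\<close>. Since \<open>u v\<^sup>-\<^sup>1\<close> determines both components, the class of \<open>z\<close> is finite exactly when
  \<open>u\<close> and \<open>v\<close> range over finite sets, namely the class of \<open>q\<close> in \<open>Q\<close> and the orbit of \<open>k\<close>.
\<close>

lemma centralizer_mem_FC_iff:
  assumes q: "q \<in> Q" and k: "k \<in> K" and inner: "\<And>x. x \<in> K \<Longrightarrow> \<theta> q x = inv k \<otimes> x \<otimes> k"
  shows "q \<otimes> inv k \<in> FC G \<longleftrightarrow>
    q \<in> FC (G\<lparr>carrier := Q\<rparr>) \<and> finite (orbit (G\<lparr>carrier := Q\<rparr>) \<theta> k)"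
proof -
  define z where "z = q \<otimes> inv k"
  have qc: "q \<in> carrier G" and kc: "k \<in> carrier G" using q k Q_closed by auto
  have zc: "z \<in> carrier G" using qc kc by (simp add: z_def)
  have central: "inv a \<otimes> z \<otimes> a = z" if a: "a \<in> K" for a
  proof -
    have ac: "a \<in> carrier G" using a by simp
    have "a \<otimes> q = q \<otimes> (inv q \<otimes> a \<otimes> q)" using ac qc by (simp add: m_assoc mult_inv_cancel)
    also have "inv q \<otimes> a \<otimes> q = inv k \<otimes> a \<otimes> k" using theta_eq[OF q a] inner[OF a] by simp
    finally have "a \<otimes> z = q \<otimes> (inv k \<otimes> a \<otimes> k) \<otimes> inv k"
      using ac qc kc by (simp add: z_def flip: m_assoc)
    also have "\<dots> = z \<otimes> a" using ac qc kc by (simp add: z_def m_assoc)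
    finally have "inv a \<otimes> (z \<otimes> a) = inv a \<otimes> (a \<otimes> z)" by simp
    thus ?thesis using ac zc by (simp add: m_assoc mult_inv_cancel)
  qed
  define p where "p b = (inv b \<otimes> q \<otimes> b, \<theta> b k)" for b
  have p: "p b \<in> Q \<times> K" if "b \<in> Q" for b
    using that q k Q Q_closed theta_eq
    by (simp add: p_def subgroup.m_closed subgroup.m_inv_closed inv_op_closed1)
  have conj_b: "inv b \<otimes> z \<otimes> b = (\<lambda>(u, v). u \<otimes> inv v) (p b)" if "b \<in> Q" for b
  proof -
    have "inv b \<otimes> inv k \<otimes> b = inv (inv b \<otimes> k \<otimes> b)"
      using that kc Q_closed by (simp add: inv_mult_group m_assoc)
    thus ?thesis
      using that qc kc k Q_closed theta_eq[OF that k] by (simp add: z_def p_def conj_mult)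
  qed
  have "conj_class G z = (\<lambda>(u, v). u \<otimes> inv v) ` p ` Q"
  proof (intro equalityI subsetI)
    fix y assume "y \<in> conj_class G z"
    then obtain g where g: "g \<in> carrier G" "y = inv g \<otimes> z \<otimes> g" by (auto simp: conj_class_def)
    obtain a b where ab: "a \<in> K" "b \<in> Q" "g = a \<otimes> b" using decompose[OF g(1)] .
    have "y = inv b \<otimes> (inv a \<otimes> z \<otimes> a) \<otimes> b"
      unfolding g(2) ab(3) using ab(1,2) Q_closed zc by (simp add: conj_conj)
    also have "\<dots> = (\<lambda>(u, v). u \<otimes> inv v) (p b)"
      using central[OF ab(1)] conj_b[OF ab(2)] by simp
    finally show "y \<in> (\<lambda>(u, v). u \<otimes> inv v) ` p ` Q" using ab(2) by blast
  next
    fix y assume "y \<in> (\<lambda>(u, v). u \<otimes> inv v) ` p ` Q"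
    then obtain b where b: "b \<in> Q" "y = (\<lambda>(u, v). u \<otimes> inv v) (p b)" by blast
    hence "y = inv b \<otimes> z \<otimes> b" using conj_b[OF b(1)] by simp
    thus "y \<in> conj_class G z" using b(1) Q_closed by (auto simp: conj_class_def)
  qed
  moreover have "inj_on (\<lambda>(u, v). u \<otimes> inv v) (p ` Q)"
  proof (rule inj_on_subset)
    show "inj_on (\<lambda>(u, v). u \<otimes> inv v) (Q \<times> K)" using mult_inv_inj by (auto simp: inj_on_def)
    show "p ` Q \<subseteq> Q \<times> K" using p by blast
  qed
  ultimately have "finite (conj_class G z) \<longleftrightarrow> finite (p ` Q)"
    by (simp add: finite_image_iff)
  also have "\<dots> \<longleftrightarrow> finite (fst ` p ` Q) \<and> finite (snd ` p ` Q)"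
  proof
    assume "finite (fst ` p ` Q) \<and> finite (snd ` p ` Q)"
    hence "finite (fst ` p ` Q \<times> snd ` p ` Q)" by blast
    thus "finite (p ` Q)" by (rule finite_subset[OF subset_fst_snd])
  qed blast
  also have "fst ` p ` Q = conj_class (G\<lparr>carrier := Q\<rparr>) q"
    using m_inv_consistent[OF Q] by (force simp: p_def conj_class_def)
  also have "snd ` p ` Q = orbit (G\<lparr>carrier := Q\<rparr>) \<theta> k"
    by (auto simp: p_def orbit_def image_image)
  finally show ?thesis using zc q by (simp add: FC_def z_def)
qed

text \<open>
  Automorphisms of \<open>K\<close> are extensional functions, so \<open>\<theta> q\<close> is equal to an inner automorphism as
  soon as the two agree on \<open>K\<close>, and then its class in \<open>Out K\<close> is trivial.
\<close>

lemma inner_imp_kernel: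
  assumes q: "q \<in> FC (G\<lparr>carrier := Q\<rparr>)" and k: "k \<in> K"
    and inner: "\<And>x. x \<in> K \<Longrightarrow> \<theta> q x = inv k \<otimes> x \<otimes> k"
  shows "q \<in> kernel (G\<lparr>carrier := FC (G\<lparr>carrier := Q\<rparr>)\<rparr>) (Out (G\<lparr>carrier := K\<rparr>))
    (to_Out (G\<lparr>carrier := K\<rparr>) \<theta>)"
proof -
  let ?K = "G\<lparr>carrier := K\<rparr>"
  have grp: "group ?K" using subgroup_axioms by (rule subgroup_imp_group)
  have theta: "\<theta> q \<in> auto ?K"
    using q theta_hom by (auto simp: FC_def hom_def carrier_Aut)
  have "\<theta> q = conj_hom ?K (carrier ?K) k"
  proof (rule extensionalityI)
    show "\<theta> q \<in> extensional K" using theta by (simp add: auto_def Bij_def)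
    show "conj_hom ?K (carrier ?K) k \<in> extensional K" by (simp add: conj_hom_def)
    show "\<theta> q x = conj_hom ?K (carrier ?K) k x" if "x \<in> K" for x
      using inner[OF that] that m_inv_consistent[OF subgroup_axioms k] by (simp add: conj_hom_def)
  qed
  hence "\<theta> q \<in> Inn ?K" using k by (simp add: Inn_def)
  hence "Inn ?K #>\<^bsub>Aut ?K\<^esub> \<theta> q = Inn ?K"
    using theta normal_imp_subgroup[OF Inn_normal[OF grp]] group_Aut[OF grp]
    by (intro group.coset_join2) (simp_all add: carrier_Aut)
  thus ?thesis using q by (simp add: kernel_def to_Out_def Out_def FactGroup_def)
qed

end

theorem theorem1:
  fixes G :: "('a, 'b) monoid_scheme" (structure)
    and K Q :: "'a set" and \<theta> \<pi> :: "'a \<Rightarrow> 'a \<Rightarrow> 'a" and \<Theta> :: "'a \<Rightarrow> ('a \<Rightarrow> 'a) set"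
  assumes "split_extension G K Q \<theta>" and "carrier G \<noteq> {\<one>}"
    and "\<pi> = conj_hom G K" and "\<Theta> = to_Out (G\<lparr>carrier := K\<rparr>) \<theta>"
  shows "\<not> icc G \<longleftrightarrow>
    (\<exists>N. N \<lhd> G\<lparr>carrier := K\<rparr> \<and> N \<noteq> {\<one>} \<and> (\<forall>g\<in>carrier G. \<pi> g ` N \<subseteq> N) \<and>
      (finite N \<or>
       (\<exists>n. G\<lparr>carrier := N\<rparr> \<cong> free_abelian_rank n) \<and> (\<forall>x\<in>N. finite (orbit G \<pi> x)))) \<or>
    (\<exists>q \<in> kernel (G\<lparr>carrier := FC (G\<lparr>carrier := Q\<rparr>)\<rparr>) (Out (G\<lparr>carrier := K\<rparr>)) \<Theta>.
      q \<noteq> \<one> \<and>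
      (\<exists>k\<in>K. finite (orbit (G\<lparr>carrier := Q\<rparr>) \<theta> k) \<and>
        (\<forall>x\<in>K. \<theta> q x = inv k \<otimes> x \<otimes> k)))"
    (is "_ \<longleftrightarrow> ?i \<or> ?ii")
proof -
  interpret split_ext G K Q \<theta> by (simp add: split_ext_def assms(1))
  have orbit: "orbit G \<pi> x = conj_class G x" if "x \<in> K" for x
    using that unfolding assms(3) by (rule orbit_conj_hom)
  show ?thesis
    unfolding not_icc_iff[OF assms(2)]
  proof
    assume "\<exists>x\<in>FC G. x \<noteq> \<one>"
    then obtain x where x: "x \<in> FC G" "x \<noteq> \<one>" by blast
    hence xc: "x \<in> carrier G" by (simp add: FC_def)
    show "?i \<or> ?ii"
    proof (cases "K \<inter> FC G \<subseteq> {\<one>}")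
      case False
      then obtain y where "y \<in> K" "y \<in> FC G" "y \<noteq> \<one>" by blast
      from normal_subgroup_of_FC_element[OF normal_axioms this]
      obtain N where N: "N \<lhd> G" "N \<subseteq> K" "N \<noteq> {\<one>}"
        "finite N \<or> (\<exists>n. G\<lparr>carrier := N\<rparr> \<cong> free_abelian_rank n) \<and> N \<subseteq> FC G" by blast
      have "N \<lhd> G\<lparr>carrier := K\<rparr>"
        using subgroup_axioms N(1,2) by (rule normal_restrict_supergroup)
      moreover have "\<pi> g ` N \<subseteq> N" if "g \<in> carrier G" for g
        using that N(2) normal.inv_op_closed1[OF N(1) that] by (auto simp: assms(3) conj_hom_def)
      moreover have "finite (orbit G \<pi> z)" if "N \<subseteq> FC G" "z \<in> N" for z
        proof -
        have "z \<in> K" "finite (conj_class G z)" using that N(2) by (auto simp: FC_def)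
        thus ?thesis using orbit by simp
      qed
      ultimately have ?i using N(3,4) by blast
      thus ?thesis ..
    next
      case True
      obtain a q where aq: "a \<in> K" "q \<in> Q" "x = a \<otimes> q" using decompose[OF xc] .
      have qc: "q \<in> carrier G" using aq(2) by (rule Q_closed)
      \<comment> \<open>Rewrites \<open>x = a q\<close> as \<open>q k\<^sup>-\<^sup>1\<close>.\<close>
      define k where "k = inv q \<otimes> inv a \<otimes> q"
      have k: "k \<in> K" unfolding k_def using qc aq(1) by (intro inv_op_closed1) auto
      have kc: "k \<in> carrier G" using k by simp
      have x_eq: "x = q \<otimes> inv k"
        using aq(1,3) qc by (simp add: k_def inv_mult_group m_assoc mult_inv_cancel)
      have q_eq: "q = x \<otimes> k" using qc kc by (simp add: x_eq m_assoc)
      have inner: "\<theta> q y = inv k \<otimes> y \<otimes> k" if y: "y \<in> K" for y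
      proof -
        \<comment> \<open>\<open>K\<close> and \<open>FC G\<close> are normal with trivial intersection, so they commute.\<close>
        have "y \<otimes> x = x \<otimes> y"
          using normal_imp_commuting[OF normal_axioms FC_normal True y x(1)] .
        hence "inv x \<otimes> y \<otimes> x = y" using xc y by (simp add: m_assoc mult_inv_cancel)
        moreover have "\<theta> q y = inv k \<otimes> (inv x \<otimes> y \<otimes> x) \<otimes> k"
          unfolding theta_eq[OF aq(2) y] unfolding q_eq using xc kc y by (simp add: conj_conj)
        ultimately show ?thesis by simp
      qed
      have fin: "q \<in> FC (G\<lparr>carrier := Q\<rparr>)" "finite (orbit (G\<lparr>carrier := Q\<rparr>) \<theta> k)"
        using centralizer_mem_FC_iff[OF aq(2) k inner] x(1) x_eq by simp_all
      have "q \<noteq> \<one>"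
      proof
        assume "q = \<one>"
        hence "x \<in> K" using aq(1,3) by simp
        thus False using True x by blast
      qed
      hence ?ii
        using inner_imp_kernel[OF fin(1) k inner] fin(2) k inner unfolding assms(4) by blast
      thus ?thesis ..
    qed
  next
    assume "?i \<or> ?ii"
    thus "\<exists>x\<in>FC G. x \<noteq> \<one>"
    proof
      assume ?i
      then obtain N where N: "N \<lhd> G\<lparr>carrier := K\<rparr>" "N \<noteq> {\<one>}"
        "\<And>g. g \<in> carrier G \<Longrightarrow> \<pi> g ` N \<subseteq> N" "finite N \<or> (\<forall>x\<in>N. finite (orbit G \<pi> x))" by blast
      have sub: "subgroup N (G\<lparr>carrier := K\<rparr>)" using N(1) by (rule normal_imp_subgroup)
      obtain x where x: "x \<in> N" "x \<noteq> \<one>" using subgroup.one_closed[OF sub] N(2) by auto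
      have xK: "x \<in> K" using subgroup.subset[OF sub] x(1) by auto
      have "orbit G \<pi> x \<subseteq> N" using N(3) x(1) by (auto simp: orbit_def)
      hence "finite (orbit G \<pi> x)" using N(4) x(1) finite_subset by blast
      hence "x \<in> FC G" using orbit[OF xK] xK by (simp add: FC_def)
      thus ?thesis using x(2) by blast
    next
      assume ?ii
      then obtain q k where q: "q \<in> FC (G\<lparr>carrier := Q\<rparr>)" "q \<noteq> \<one>" and k: "k \<in> K"
        and orb: "finite (orbit (G\<lparr>carrier := Q\<rparr>) \<theta> k)"
        and inner: "\<And>x. x \<in> K \<Longrightarrow> \<theta> q x = inv k \<otimes> x \<otimes> k"
        by (auto simp: kernel_def)
      have qQ: "q \<in> Q" using q(1) by (simp add: FC_def)
      have "q \<otimes> inv k \<in> FC G"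
        using centralizer_mem_FC_iff[OF qQ k inner] q(1) orb by simp
      moreover have "q \<otimes> inv k \<noteq> \<one>"
        using mult_inv_inj[of q \<one> k \<one>] qQ k q(2) subgroup.one_closed[OF Q] by auto
      ultimately show ?thesis by blast
    qed
  qed
qed

end
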